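(* Let $M$ be a cofinitary regular matroid with ground set $E$, equipped with a signing $(f_C)$, $(g_U)$, and let $e\in E$. Then either there is a directed circuit of $M$ containing $e$ or else there is a directed cocircuit of $M$ containing $e$.
   Context: Matroids are in the sense of Bruhn, Diestel, Kriesell, Pendavingh and Wollan (possibly infinite ground set). A matroid is cofinitary if its dual is finitary, i.e. every cocircuit is finite (such matroids are tame: every circuit–cocircuit intersection is finite). A tame matroid $M$ is regular if it is signable: for each circuit $C$ and each cocircuit $U$ of $M$ there are functions $f_C\colon C\to\{-1,1\}$ and $g_U\colon U\to\{-1,1\}$ (a signing) such that $\sum_{e\in C\cap U} f_C(e)g_U(e)=0$ over $\mathbb{Z}$ for every circuit $C$ and cocircuit $U$. A circuit $C$ is directed if $f_C$ is constant; a cocircuit $U$ is directed if $g_U$ is constant. *)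

theory Defs
  imports Main
begin

definition base :: "('a set \<Rightarrow> bool) \<Rightarrow> 'a set \<Rightarrow> bool" where
  "base indep B \<longleftrightarrow> indep B \<and> (\<forall>I. indep I \<longrightarrow> B \<subseteq> I \<longrightarrow> I = B)"

text \<open>The independence axioms (I1), (I2), (I3), (IM) of Bruhn, Diestel, Kriesell, Pendavingh and
  Wollan for matroids on a possibly infinite ground set.\<close>

locale matroid =
  fixes E :: "'a set" and indep :: "'a set \<Rightarrow> bool"
  assumes indep_subset_ground: "indep I \<Longrightarrow> I \<subseteq> E"
    and indep_empty: "indep {}"
    and indep_subset: "indep I \<Longrightarrow> J \<subseteq> I \<Longrightarrow> indep J"
    and indep_augment: "indep I \<Longrightarrow> \<not> base indep I \<Longrightarrow> base indep B \<Longrightarrow>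
      \<exists>x \<in> B - I. indep (insert x I)"
    and indep_maximal: "indep I \<Longrightarrow> I \<subseteq> X \<Longrightarrow> X \<subseteq> E \<Longrightarrow>
      \<exists>J. indep J \<and> I \<subseteq> J \<and> J \<subseteq> X \<and> (\<forall>K. indep K \<longrightarrow> J \<subseteq> K \<longrightarrow> K \<subseteq> X \<longrightarrow> K = J)"

definition circuit :: "'a set \<Rightarrow> ('a set \<Rightarrow> bool) \<Rightarrow> 'a set \<Rightarrow> bool" where
  "circuit E indep C \<longleftrightarrow> C \<subseteq> E \<and> \<not> indep C \<and> (\<forall>D. D \<subset> C \<longrightarrow> indep D)"

text \<open>The bases of the dual matroid are the complements of the bases.\<close>

definition dual_indep :: "'a set \<Rightarrow> ('a set \<Rightarrow> bool) \<Rightarrow> 'a set \<Rightarrow> bool" where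
  "dual_indep E indep I \<longleftrightarrow> (\<exists>B. base indep B \<and> I \<subseteq> E - B)"

definition cocircuit :: "'a set \<Rightarrow> ('a set \<Rightarrow> bool) \<Rightarrow> 'a set \<Rightarrow> bool" where
  "cocircuit E indep = circuit E (dual_indep E indep)"

definition finitary :: "'a set \<Rightarrow> ('a set \<Rightarrow> bool) \<Rightarrow> bool" where
  "finitary E indep \<longleftrightarrow> (\<forall>C. circuit E indep C \<longrightarrow> finite C)"

definition cofinitary :: "'a set \<Rightarrow> ('a set \<Rightarrow> bool) \<Rightarrow> bool" where
  "cofinitary E indep \<longleftrightarrow> finitary E (dual_indep E indep)"

definition tame :: "'a set \<Rightarrow> ('a set \<Rightarrow> bool) \<Rightarrow> bool" where
  "tame E indep \<longleftrightarrow>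
    (\<forall>C U. circuit E indep C \<longrightarrow> cocircuit E indep U \<longrightarrow> finite (C \<inter> U))"

text \<open>Only the values of \<^term>\<open>f C\<close> on \<^term>\<open>C\<close> and of \<^term>\<open>g U\<close> on \<^term>\<open>U\<close> are relevant.
  The sum has its intended meaning only for tame matroids, where \<^term>\<open>C \<inter> U\<close> is finite.\<close>

definition signing ::
  "'a set \<Rightarrow> ('a set \<Rightarrow> bool) \<Rightarrow> ('a set \<Rightarrow> 'a \<Rightarrow> int) \<Rightarrow> ('a set \<Rightarrow> 'a \<Rightarrow> int) \<Rightarrow> bool" where
  "signing E indep f g \<longleftrightarrow>
    (\<forall>C. circuit E indep C \<longrightarrow> f C ` C \<subseteq> {-1, 1}) \<and>
    (\<forall>U. cocircuit E indep U \<longrightarrow> g U ` U \<subseteq> {-1, 1}) \<and>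
    (\<forall>C U. circuit E indep C \<longrightarrow> cocircuit E indep U \<longrightarrow> (\<Sum>x \<in> C \<inter> U. f C x * g U x) = 0)"

definition regular_matroid :: "'a set \<Rightarrow> ('a set \<Rightarrow> bool) \<Rightarrow> bool" where
  "regular_matroid E indep \<longleftrightarrow> matroid E indep \<and> tame E indep \<and> (\<exists>f g. signing E indep f g)"

text \<open>For both circuits (with \<^term>\<open>s = f\<close>) and cocircuits (with \<^term>\<open>s = g\<close>) of a signing.\<close>

definition directed :: "('a set \<Rightarrow> 'a \<Rightarrow> int) \<Rightarrow> 'a set \<Rightarrow> bool" where
  "directed s C \<longleftrightarrow> (\<exists>c. \<forall>x \<in> C. s C x = c)"

end

theory Submission
  imports Defs
begin

text \<open>Minty's painting lemma for partitions with finitely many directed elements and arbitrarily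
  many free ones holds by induction as in the finite case. Suppose no directed cocircuit contains
  \<open>e\<close>. As cocircuits are finite, Zorn's lemma yields a minimal set \<open>X\<close> containing \<open>e\<close> such that no
  cocircuit through \<open>e\<close> has constant sign on \<open>X\<close>. Applying the painting lemma to \<open>X \<inter> F\<close> for large
  finite \<open>F\<close> shows that the indicator function of \<open>X\<close> is orthogonal to all cocircuits through \<open>e\<close>.
  Now let \<open>C \<subseteq> X\<close> be a circuit through \<open>e\<close> with \<open>f\<^sub>C e = 1\<close>. The nonnegative function \<open>1\<^sub>X + f\<^sub>C\<close> is
  orthogonal to these cocircuits too and positive at \<open>e\<close>, so its support inherits the property
  defining \<open>X\<close>. By minimality the support is \<open>X\<close>, that is, \<open>f\<^sub>C\<close> never takes the value \<open>-1\<close>.\<close>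

lemma finite_cocircuit: "cofinitary E indep \<Longrightarrow> cocircuit E indep U \<Longrightarrow> finite U"
  by (simp add: cofinitary_def finitary_def cocircuit_def)

section \<open>Fundamental circuits and cocircuits\<close>

context matroid
begin

lemma indep_extends_to_base:
  assumes "indep I"
  obtains B where "base indep B" "I \<subseteq> B"
proof -
  obtain J where J: "indep J" "I \<subseteq> J"
    "\<forall>K. indep K \<longrightarrow> J \<subseteq> K \<longrightarrow> K \<subseteq> E \<longrightarrow> K = J"
    using indep_maximal[OF assms indep_subset_ground[OF assms] subset_refl] by blast
  then have "base indep J"
    unfolding base_def using indep_subset_ground by blast
  with J that show thesis by blast
qed

lemma base_indep: "base indep B \<Longrightarrow> indep B"
  by (simp add: base_def)

lemma base_maximal: "base indep B \<Longrightarrow> x \<notin> B \<Longrightarrow> \<not> indep (insert x B)"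
  by (auto simp: base_def)

text \<open>Were \<open>?C\<close> independent, a maximal independent \<open>J\<close> between
  \<open>?C\<close> and \<open>insert e B\<close> would be a base. It misses some \<open>x\<close>,
  and even a second element \<open>x'\<close>, since \<open>x\<close> lies outside
  \<open>?C\<close>. Base exchange rules this out.\<close>

lemma fundamental_circuit_base:
  assumes B: "base indep B" and e: "e \<in> E" "e \<notin> B"
  shows "circuit E indep {x \<in> insert e B. indep (insert e B - {x})}" (is "circuit E indep ?C")
proof -
  have eC: "e \<in> ?C"
    using base_indep[OF B] e by auto
  have "\<not> indep ?C"
  proof
    assume indepC: "indep ?C"
    have "insert e B \<subseteq> E"
      using indep_subset_ground[OF base_indep[OF B]] e by simp
    moreover have "?C \<subseteq> insert e B" by blast
    ultimately obtain J where J: "indep J" "?C \<subseteq> J" "J \<subseteq> insert e B"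
      and Jmax: "\<And>K. indep K \<Longrightarrow> J \<subseteq> K \<Longrightarrow> K \<subseteq> insert e B \<Longrightarrow> K = J"
      using indep_maximal[OF indepC, of "insert e B"] by metis
    have baseJ: "base indep J"
    proof (rule ccontr)
      assume "\<not> base indep J"
      then obtain y where "y \<in> B - J" "indep (insert y J)"
        using indep_augment[OF J(1) _ B] by blast
      then show False
        using Jmax[of "insert y J"] J(3) by blast
    qed
    obtain x where x: "x \<in> insert e B" "x \<notin> J"
      using indep_subset[OF J(1), of "insert e B"] base_maximal[OF B e(2)] by blast
    have "\<not> indep (insert e B - {x})"
      using x J(2) by blast
    then obtain x' where x': "x' \<in> insert e B" "x' \<notin> J" "x' \<noteq> x"
      using indep_subset[OF J(1), of "insert e B - {x}"] by blast
    \<comment> \<open>Exchanging \<open>e\<close> for \<open>x\<close> in \<open>J\<close> gives a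
      subset of \<open>B\<close> missing \<open>x'\<close>, hence not a base. Augmenting it from
      \<open>J\<close> can only add \<open>e\<close>, which makes \<open>insert x J\<close>
      independent.\<close>
    let ?K = "insert x (J - {e})"
    have ne: "x \<noteq> e" "x' \<noteq> e"
      using x x' eC J(2) by blast+
    have K: "?K \<subseteq> B" "x' \<in> B - ?K"
      using x x' ne J(3) by auto
    have "indep ?K"
      using indep_subset[OF base_indep[OF B] K(1)] .
    moreover have "\<not> base indep ?K"
      using K base_indep[OF B] unfolding base_def by blast
    ultimately obtain y where "y \<in> J - ?K" "indep (insert y ?K)"
      using indep_augment baseJ by blast
    moreover from this have "insert y ?K = insert x J"
      using x by blast
    ultimately show False
      using base_maximal[OF baseJ x(2)] by simp
  qed
  moreover have "indep D" if "D \<subset> ?C" for D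
  proof -
    obtain x where "x \<in> ?C" "x \<notin> D" using \<open>D \<subset> ?C\<close> by blast
    moreover from this that have "D \<subseteq> insert e B - {x}" by blast
    ultimately show ?thesis
      using indep_subset by blast
  qed
  moreover have "?C \<subseteq> E"
    using indep_subset_ground[OF base_indep[OF B]] e by auto
  ultimately show ?thesis
    by (simp add: circuit_def)
qed

lemma fundamental_circuit:
  assumes I: "indep I" and e: "e \<in> E" and dep: "\<not> indep (insert e I)"
  obtains C where "circuit E indep C" "e \<in> C" "C \<subseteq> insert e I"
proof -
  obtain B where B: "base indep B" "I \<subseteq> B"
    using indep_extends_to_base[OF I] .
  have eB: "e \<notin> B"
    using dep B base_indep indep_subset by blast
  let ?C = "{x \<in> insert e B. indep (insert e B - {x})}"
  have "e \<in> ?C"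
    using base_indep[OF B(1)] eB by auto
  moreover have "?C \<subseteq> insert e I"
  proof
    fix x assume x: "x \<in> ?C"
    show "x \<in> insert e I"
    proof (rule ccontr)
      assume "x \<notin> insert e I"
      then have "insert e I \<subseteq> insert e B - {x}" using B(2) by blast
      with x dep show False using indep_subset by blast
    qed
  qed
  ultimately show thesis
    using fundamental_circuit_base[OF B(1) e eB] that by blast
qed

text \<open>\<open>?U\<close> is the complement of the closure of \<open>B - {e}\<close>. Every base
  meets it, as \<open>B - {e}\<close> can be augmented from any base; and for each \<open>x\<close>
  in \<open>?U\<close> the base \<open>insert x (B - {e})\<close> meets it in \<open>x\<close>
  only.\<close>

lemma fundamental_cocircuit:
  assumes B: "base indep B" and e: "e \<in> B"
  shows "cocircuit E indep {x. x \<notin> B - {e} \<and> indep (insert x (B - {e}))}"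
    (is "cocircuit E indep ?U")
proof -
  have "\<not> dual_indep E indep ?U"
  proof
    assume "dual_indep E indep ?U"
    then obtain B' where B': "base indep B'" "?U \<inter> B' = {}"
      by (auto simp: dual_indep_def)
    have "indep (B - {e})" "\<not> base indep (B - {e})"
      using B e indep_subset[of B "B - {e}"] by (auto simp: base_def)
    then obtain x where "x \<in> B' - (B - {e})" "indep (insert x (B - {e}))"
      using indep_augment B'(1) by blast
    with B'(2) show False by blast
  qed
  moreover have "dual_indep E indep D" if "D \<subset> ?U" for D
  proof -
    obtain x where x: "x \<in> ?U" "x \<notin> D" using \<open>D \<subset> ?U\<close> by blast
    let ?B = "insert x (B - {e})"
    have "base indep ?B"
    proof (rule ccontr)
      assume nb: "\<not> base indep ?B"
      then obtain y where y: "y \<in> B - ?B" "indep (insert y ?B)"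
        using indep_augment[of ?B B] x(1) B by blast
      then have "y = e" "x \<noteq> e" by auto
      then have "insert y ?B = insert x B" "x \<notin> B"
        using e x by auto
      with y base_maximal[OF B] show False by simp
    qed
    moreover have "D \<subseteq> E - ?B"
      using that x(2) indep_subset_ground by blast
    ultimately show ?thesis
      unfolding dual_indep_def by blast
  qed
  moreover have "?U \<subseteq> E"
    using indep_subset_ground by blast
  ultimately show ?thesis
    by (simp add: cocircuit_def circuit_def)
qed

text \<open>The painting lemma without directed elements. Let \<open>I\<close> be maximal
  independent in \<open>Y - {e}\<close>. If \<open>I\<close> spans \<open>e\<close>, there is a
  circuit; otherwise the fundamental cocircuit of \<open>e\<close> for a base containing
  \<open>insert e I\<close> avoids \<open>Y - {e}\<close> by maximality of \<open>I\<close>.\<close>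

lemma circuit_or_cocircuit:
  assumes e: "e \<in> E" and Y: "Y \<subseteq> E"
  shows "(\<exists>C. circuit E indep C \<and> e \<in> C \<and> C \<subseteq> insert e Y) \<or>
    (\<exists>U. cocircuit E indep U \<and> e \<in> U \<and> U \<inter> Y \<subseteq> {e})"
proof -
  obtain I where I: "indep I" "I \<subseteq> Y - {e}"
    and Imax: "\<And>K. indep K \<Longrightarrow> I \<subseteq> K \<Longrightarrow> K \<subseteq> Y - {e} \<Longrightarrow> K = I"
    using indep_maximal[OF indep_empty, of "Y - {e}"] Y by blast
  show ?thesis
  proof (cases "indep (insert e I)")
    case False
    then obtain C where "circuit E indep C" "e \<in> C" "C \<subseteq> insert e I"
      using fundamental_circuit I(1) e by blast
    with I(2) show ?thesis by blast
  next
    case True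
    then obtain B where B: "base indep B" "insert e I \<subseteq> B"
      by (rule indep_extends_to_base)
    let ?U = "{x. x \<notin> B - {e} \<and> indep (insert x (B - {e}))}"
    have "e \<in> ?U"
      using B base_indep by (auto simp: insert_absorb)
    moreover have "?U \<inter> Y \<subseteq> {e}"
    proof
      fix x assume x: "x \<in> ?U \<inter> Y"
      show "x \<in> {e}"
      proof (rule ccontr)
        assume "x \<notin> {e}"
        moreover have "insert x I \<subseteq> insert x (B - {e})"
          using B(2) I(2) by blast
        ultimately have "insert x I = I"
          using x I(2) Imax[of "insert x I"] indep_subset by blast
        with x B(2) \<open>x \<notin> {e}\<close> show False by blast
      qed
    qed
    ultimately show ?thesis
      using fundamental_cocircuit[OF B(1), of e] B(2) by blast
  qed
qed

end

section \<open>Orthogonality of signs and the painting lemma\<close>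

locale signed_tame_matroid = matroid +
  fixes f g :: "'a set \<Rightarrow> 'a \<Rightarrow> int"
  assumes tame: "tame E indep"
    and signing: "signing E indep f g"
begin

lemma finite_circuit_Int_cocircuit:
  "circuit E indep C \<Longrightarrow> cocircuit E indep U \<Longrightarrow> finite (C \<inter> U)"
  using tame by (simp add: tame_def)

lemma orthogonal:
  "circuit E indep C \<Longrightarrow> cocircuit E indep U \<Longrightarrow> (\<Sum>x \<in> C \<inter> U. f C x * g U x) = 0"
  using signing by (simp add: signing_def)

lemma circuit_sign: "circuit E indep C \<Longrightarrow> x \<in> C \<Longrightarrow> f C x = 1 \<or> f C x = -1"
  using signing unfolding signing_def by blast

lemma cocircuit_sign: "cocircuit E indep U \<Longrightarrow> x \<in> U \<Longrightarrow> g U x = 1 \<or> g U x = -1"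
  using signing unfolding signing_def by blast

text \<open>Otherwise the orthogonality sum would be a nonzero number of copies of 1 or of
  -1.\<close>

lemma products_not_constant:
  assumes C: "circuit E indep C" and U: "cocircuit E indep U" and e: "e \<in> C" "e \<in> U"
  obtains x where "x \<in> C \<inter> U" "f C x * g U x \<noteq> f C e * g U e"
proof (rule ccontr)
  assume "\<not> thesis"
  then have "(\<Sum>x \<in> C \<inter> U. f C x * g U x) = (\<Sum>x \<in> C \<inter> U. f C e * g U e)"
    using that by (intro sum.cong) auto
  moreover have "card (C \<inter> U) \<noteq> 0"
    using finite_circuit_Int_cocircuit[OF C U] e by auto
  moreover have "f C e * g U e \<noteq> 0"
    using circuit_sign[OF C e(1)] cocircuit_sign[OF U e(2)] by auto
  ultimately show False
    using orthogonal[OF C U] by simp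
qed

text \<open>Elements of \<open>X\<close> are directed, those of \<open>Y\<close> may be used freely
  by circuits, and the remaining ones except \<open>e\<close> freely by cocircuits. In the induction
  step, \<open>y\<close> is moved to each of the two free classes in turn. If neither outcome is
  good for the original painting, \<open>y\<close> lies in both \<open>C\<close> and
  \<open>U\<close> with the sign opposite to that of \<open>e\<close>, so all products on their
  intersection agree.\<close>

lemma painting:
  assumes "finite X" "X \<subseteq> E" "Y \<subseteq> E" "e \<in> E" "e \<notin> X" "e \<notin> Y" "X \<inter> Y = {}"
  shows "(\<exists>C. circuit E indep C \<and> e \<in> C \<and> C \<subseteq> insert e (X \<union> Y) \<and>
      (\<forall>x \<in> C \<inter> X. f C x = f C e)) \<or>
    (\<exists>U. cocircuit E indep U \<and> e \<in> U \<and> U \<inter> Y = {} \<and> (\<forall>x \<in> U \<inter> X. g U x = g U e))"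
  using assms
proof (induction X arbitrary: Y rule: finite_induct)
  case empty
  then show ?case
    using circuit_or_cocircuit[of e Y] by auto
next
  case (insert y X)
  show ?case
  proof (rule ccontr)
    assume neg: "\<not> ?case"
    have "\<exists>C. circuit E indep C \<and> e \<in> C \<and> C \<subseteq> Set.insert e (X \<union> Set.insert y Y) \<and>
      (\<forall>x \<in> C \<inter> X. f C x = f C e)"
      using insert.IH[of "Set.insert y Y"] insert.prems insert.hyps neg by blast
    then obtain C where C: "circuit E indep C" "e \<in> C" "C \<subseteq> Set.insert e (X \<union> Set.insert y Y)"
      "\<And>x. x \<in> C \<inter> X \<Longrightarrow> f C x = f C e"
      by blast
    have "\<exists>U. cocircuit E indep U \<and> e \<in> U \<and> U \<inter> Y = {} \<and> (\<forall>x \<in> U \<inter> X. g U x = g U e)"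
      using insert.IH[of Y] insert.prems neg by blast
    then obtain U where U: "cocircuit E indep U" "e \<in> U" "U \<inter> Y = {}"
      "\<And>x. x \<in> U \<inter> X \<Longrightarrow> g U x = g U e"
      by blast
    have yC: "y \<in> C" "f C y \<noteq> f C e"
      using neg C by blast+
    have yU: "y \<in> U" "g U y \<noteq> g U e"
      using neg U by blast+
    obtain x where x: "x \<in> C \<inter> U" "f C x * g U x \<noteq> f C e * g U e"
      using products_not_constant[OF C(1) U(1) C(2) U(2)] .
    then have "x = e \<or> x = y \<or> x \<in> X"
      using C(3) U(3) by blast
    moreover have "f C y = - f C e" "g U y = - g U e"
      using yC yU circuit_sign[OF C(1,2)] circuit_sign[OF C(1) yC(1)]
        cocircuit_sign[OF U(1,2)] cocircuit_sign[OF U(1) yU(1)] by auto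
    ultimately show False
      using x C(4) U(4) by auto
  qed
qed

lemma not_directed_circuit_and_cocircuit:
  assumes "circuit E indep C" "directed f C" "e \<in> C"
    and "cocircuit E indep U" "directed g U" "e \<in> U"
  shows False
  using products_not_constant[OF assms(1,4,3,6)] assms unfolding directed_def by (metis IntE)

section \<open>Minimal sets on which no cocircuit through \<open>e\<close> has constant sign\<close>

definition unbalanced :: "'a \<Rightarrow> 'a set \<Rightarrow> bool" where
  "unbalanced e X \<longleftrightarrow>
    (\<forall>U. cocircuit E indep U \<longrightarrow> e \<in> U \<longrightarrow> (\<exists>x \<in> U \<inter> X. g U x \<noteq> g U e))"

lemma minimal_unbalanced:
  assumes cofin: "cofinitary E indep"
    and e: "e \<in> E" and E: "unbalanced e E"
  obtains X where "X \<subseteq> E" "e \<in> X" "unbalanced e X"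
    "\<forall>X'. X' \<subset> X \<longrightarrow> e \<in> X' \<longrightarrow> \<not> unbalanced e X'"
proof -
  \<comment> \<open>Zorn's lemma yields maximal sets, so it is applied to the complements
    \<open>W\<close> of the candidates.\<close>
  let ?A = "{W. W \<subseteq> E - {e} \<and> unbalanced e (E - W)}"
  have "\<exists>M\<in>?A. \<forall>W\<in>?A. M \<subseteq> W \<longrightarrow> W = M"
  proof (rule subset_Zorn_nonempty)
    have "{} \<in> ?A" using E by simp
    then show "?A \<noteq> {}" by blast
  next
    fix \<C> assume ne: "\<C> \<noteq> {}" and chain: "subset.chain ?A \<C>"
    then have sub: "\<And>W. W \<in> \<C> \<Longrightarrow> W \<subseteq> E - {e} \<and> unbalanced e (E - W)"
      by (auto simp: subset.chain_def)
    have "unbalanced e (E - \<Union>\<C>)"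
      unfolding unbalanced_def
    proof (intro allI impI)
      fix U assume U: "cocircuit E indep U" "e \<in> U"
      \<comment> \<open>As \<open>U\<close> is finite, a single member of the chain already removes
        all that the union removes from \<open>U\<close>.\<close>
      obtain W where W: "W \<in> \<C>" "U \<inter> \<Union>\<C> \<subseteq> W"
        using finite_subset_Union_chain[OF _ _ ne chain, of "U \<inter> \<Union>\<C>"] finite_cocircuit[OF cofin U(1)] by auto
      then have "unbalanced e (E - W)" using sub by blast
      then obtain x where "x \<in> U \<inter> (E - W)" "g U x \<noteq> g U e"
        using U unfolding unbalanced_def by blast
      with W show "\<exists>x \<in> U \<inter> (E - \<Union>\<C>). g U x \<noteq> g U e" by blast
    qed
    moreover have "\<Union>\<C> \<subseteq> E - {e}"
      using sub by (intro Union_least) simp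
    ultimately show "\<Union>\<C> \<in> ?A" by simp
  qed
  then obtain M where M: "M \<subseteq> E - {e}" "unbalanced e (E - M)"
    and Mmax: "\<And>W. W \<subseteq> E - {e} \<Longrightarrow> unbalanced e (E - W) \<Longrightarrow> M \<subseteq> W \<Longrightarrow> W = M"
    by auto
  show thesis
  proof (rule that[of "E - M"])
    show "\<forall>X'. X' \<subset> E - M \<longrightarrow> e \<in> X' \<longrightarrow> \<not> unbalanced e X'"
    proof (intro allI impI notI)
      fix X' assume X': "X' \<subset> E - M" "e \<in> X'"
      assume "unbalanced e X'"
      moreover have "E - (E - X') = X'" "E - X' \<subseteq> E - {e}" "M \<subseteq> E - X'"
        using X' M(1) by blast+
      ultimately have "E - X' = M" using Mmax by simp
      with X' show False by blast
    qed
    show "e \<in> E - M" using M(1) e by blast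
  qed (use M in simp_all)
qed

text \<open>Painting gives a circuit \<open>C\<close> of constant sign on \<open>F\<close> with
  \<open>C\<close> and \<open>X\<close> agreeing on \<open>U\<close>, so orthogonality of
  \<open>C\<close> and \<open>U\<close> transfers to \<open>X\<close>. The cocircuits
  \<open>V y\<close>, which witness that \<open>X - {y}\<close> is too small, force \<open>C\<close>
  to contain all of \<open>X\<close> inside \<open>U\<close>.\<close>

lemma minimal_unbalanced_orthogonal:
  assumes cofin: "cofinitary E indep"
    and X: "X \<subseteq> E" "e \<in> X" "unbalanced e X"
    and min: "\<forall>X'. X' \<subset> X \<longrightarrow> e \<in> X' \<longrightarrow> \<not> unbalanced e X'"
    and U: "cocircuit E indep U" "e \<in> U"
  shows "(\<Sum>x \<in> X \<inter> U. g U x) = 0"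
proof -
  have "\<exists>V. cocircuit E indep V \<and> e \<in> V \<and> (\<forall>x \<in> V \<inter> (X - {y}). g V x = g V e)"
    if "y \<in> X - {e}" for y
    using min[rule_format, of "X - {y}"] that X(2) unfolding unbalanced_def by blast
  then obtain V where V: "\<And>y. y \<in> X - {e} \<Longrightarrow> cocircuit E indep (V y)"
    "\<And>y. y \<in> X - {e} \<Longrightarrow> e \<in> V y"
    "\<And>y x. y \<in> X - {e} \<Longrightarrow> x \<in> V y \<inter> (X - {y}) \<Longrightarrow> g (V y) x = g (V y) e"
    by metis
  define F where "F = U \<union> (\<Union>y \<in> U \<inter> X - {e}. V y)"
  have finF: "finite F"
    unfolding F_def using finite_cocircuit[OF cofin U(1)] finite_cocircuit[OF cofin V(1)] by auto
  have FE: "F \<subseteq> E"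
    unfolding F_def using U(1) V(1) by (fastforce simp: cocircuit_def circuit_def)
  \<comment> \<open>Elements of \<open>X\<close> in \<open>F\<close> are directed and everything
    outside \<open>F\<close> is free for circuits. A cocircuit outcome would lie in \<open>F\<close>
    with constant sign on \<open>X\<close>, against \<open>unbalanced e X\<close>.\<close>
  have "(\<exists>C. circuit E indep C \<and> e \<in> C \<and> C \<subseteq> insert e ((X \<inter> F - {e}) \<union> (E - F)) \<and>
      (\<forall>x \<in> C \<inter> (X \<inter> F - {e}). f C x = f C e)) \<or>
    (\<exists>U. cocircuit E indep U \<and> e \<in> U \<and> U \<inter> (E - F) = {} \<and>
      (\<forall>x \<in> U \<inter> (X \<inter> F - {e}). g U x = g U e))"
    using finF X U(2) by (intro painting) (auto simp: F_def)
  moreover have False if U': "cocircuit E indep U'" "e \<in> U'" "U' \<inter> (E - F) = {}"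
    "\<forall>x \<in> U' \<inter> (X \<inter> F - {e}). g U' x = g U' e" for U'
  proof -
    obtain x where "x \<in> U' \<inter> X" "g U' x \<noteq> g U' e"
      using X(3) U'(1,2) unfolding unbalanced_def by blast
    with U'(3,4) X(1) show False by blast
  qed
  ultimately obtain C where C: "circuit E indep C" "e \<in> C"
    "C \<subseteq> insert e ((X \<inter> F - {e}) \<union> (E - F))"
    "\<And>x. x \<in> C \<inter> (X \<inter> F - {e}) \<Longrightarrow> f C x = f C e"
    by blast
  have CX: "x \<in> X" "f C x = f C e" if "x \<in> C \<inter> F" for x
    using that C(3) C(4)[of x] X(2) by (cases "x = e"; blast)+
  have "y \<in> C" if y: "y \<in> U \<inter> X" for y
  proof (rule ccontr)
    assume yC: "y \<notin> C"
    then have y': "y \<in> X - {e}" using y C(2) by blast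
    obtain x where x: "x \<in> C \<inter> V y" "f C x * g (V y) x \<noteq> f C e * g (V y) e"
      using products_not_constant[OF C(1) V(1)[OF y'] C(2) V(2)[OF y']] .
    \<comment> \<open>Thus \<open>x\<close> lies in \<open>X - {y}\<close>, where \<open>V y\<close>
      has the sign it has at \<open>e\<close>; so does \<open>C\<close> at \<open>x\<close>, and the
      two products agree after all.\<close>
    have "x \<in> C \<inter> F" using x y y' unfolding F_def by blast
    with CX[of x] V(3)[OF y', of x] x yC show False by auto
  qed
  then have "C \<inter> U = X \<inter> U"
    using CX(1) unfolding F_def by blast
  moreover have "(\<Sum>x \<in> C \<inter> U. f C x * g U x) = (\<Sum>x \<in> C \<inter> U. f C e * g U x)"
    using CX(2) unfolding F_def by (intro sum.cong) auto
  ultimately have "f C e * (\<Sum>x \<in> X \<inter> U. g U x) = 0"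
    using orthogonal[OF C(1) U(1)] by (simp add: sum_distrib_left)
  then show ?thesis
    using circuit_sign[OF C(1,2)] by auto
qed

section \<open>The dichotomy\<close>

lemma directed_circuit_or_cocircuit:
  assumes cofin: "cofinitary E indep" and e: "e \<in> E"
  shows "(\<exists>C. circuit E indep C \<and> directed f C \<and> e \<in> C) \<or>
    (\<exists>U. cocircuit E indep U \<and> directed g U \<and> e \<in> U)"
proof (cases "unbalanced e E")
  case False
  then obtain U where U: "cocircuit E indep U" "e \<in> U" "\<forall>x \<in> U \<inter> E. g U x = g U e"
    unfolding unbalanced_def by blast
  moreover from U(1) have "U \<subseteq> E"
    by (simp add: cocircuit_def circuit_def)
  ultimately have "directed g U"
    unfolding directed_def by blast
  with U show ?thesis by blast
next
  case True
  obtain X where X: "X \<subseteq> E" "e \<in> X" "unbalanced e X"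
    and min: "\<forall>X'. X' \<subset> X \<longrightarrow> e \<in> X' \<longrightarrow> \<not> unbalanced e X'"
    using minimal_unbalanced[OF cofin e True] .
  have "\<not> (\<exists>U. cocircuit E indep U \<and> e \<in> U \<and> U \<inter> X \<subseteq> {e})"
    using X(3) unfolding unbalanced_def by blast
  then obtain C where C: "circuit E indep C" "e \<in> C" "C \<subseteq> X"
    using circuit_or_cocircuit[OF e X(1)] X(2) by blast
  have "f C y = f C e" if y: "y \<in> C" for y
  proof (rule ccontr)
    assume neq: "f C y \<noteq> f C e"
    \<comment> \<open>This is the support in \<open>X\<close> of the function \<open>h\<close>
      defined below, and it misses \<open>y\<close>.\<close>
    let ?P = "X - {x \<in> C. f C x \<noteq> f C e}"
    have "\<not> unbalanced e ?P"
      by (rule min[rule_format]) (use y neq C X(2) in auto)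
    then obtain U where U: "cocircuit E indep U" "e \<in> U"
      and const: "\<And>x. x \<in> U \<inter> ?P \<Longrightarrow> g U x = g U e"
      unfolding unbalanced_def by blast
    \<comment> \<open>\<open>1\<^sub>X + f\<^sub>C\<close> scaled by \<open>f\<^sub>C e\<close> to cover both signs of \<open>f\<^sub>C e\<close>\<close>
    define h where "h x = 1 + (if x \<in> C then f C e * f C x else 0)" for x
    have finXU: "finite (X \<inter> U)" using finite_cocircuit[OF cofin U(1)] by blast
    have "(\<Sum>x \<in> X \<inter> U. (if x \<in> C then f C e * f C x else 0) * g U x)
        = (\<Sum>x \<in> C \<inter> U. f C e * (f C x * g U x))"
      using C(3) finXU by (intro sum.mono_neutral_cong_right) auto
    also have "\<dots> = 0"
      using orthogonal[OF C(1) U(1)] by (simp flip: sum_distrib_left)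
    finally have "(\<Sum>x \<in> X \<inter> U. (if x \<in> C then f C e * f C x else 0) * g U x) = 0" .
    moreover have "(\<Sum>x \<in> X \<inter> U. g U x) = 0"
      by (rule minimal_unbalanced_orthogonal[OF cofin X min U])
    ultimately have "(\<Sum>x \<in> X \<inter> U. h x * g U x) = 0"
      by (simp add: h_def distrib_right sum.distrib)
    \<comment> \<open>On \<open>?P\<close> the sign of \<open>U\<close> is that at \<open>e\<close>;
      off \<open>?P\<close> the factor \<open>h x\<close> vanishes. Hence the zero sum is
      \<open>g U e\<close> times a sum of nonnegative terms, of which the one at \<open>e\<close> is
      2.\<close>
    moreover have "h x * g U x = h x * g U e" if "x \<in> X \<inter> U" for x
    proof (cases "x \<in> ?P")
      case True
      with const that show ?thesis by simp
    next
      case False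
      with that have x: "x \<in> C" "f C x \<noteq> f C e" by auto
      then have "f C e * f C x = -1"
        using circuit_sign[OF C(1,2)] circuit_sign[OF C(1) x(1)] by auto
      with x show ?thesis by (simp add: h_def)
    qed
    ultimately have "(\<Sum>x \<in> X \<inter> U. h x) * g U e = 0"
      by (simp add: sum_distrib_right)
    moreover have "(\<Sum>x \<in> X \<inter> U. h x) > 0"
    proof (rule sum_pos2[OF finXU])
      show "e \<in> X \<inter> U" using X U by blast
      show "0 < h e"
        using circuit_sign[OF C(1,2)] C(2) by (auto simp: h_def)
      show "0 \<le> h x" for x
        using circuit_sign[OF C(1,2)] circuit_sign[OF C(1), of x] by (auto simp: h_def)
    qed
    ultimately show False
      using cocircuit_sign[OF U] by auto
  qed
  then have "directed f C"
    unfolding directed_def by blast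
  with C show ?thesis by blast
qed

end

theorem theorem5p30:
  fixes E :: "'a set" and indep :: "'a set \<Rightarrow> bool"
    and f g :: "'a set \<Rightarrow> 'a \<Rightarrow> int" and e :: 'a
  assumes "matroid E indep"
    and "cofinitary E indep"
    and "regular_matroid E indep"
    and "signing E indep f g"
    and "e \<in> E"
  shows "((\<exists>C. circuit E indep C \<and> directed f C \<and> e \<in> C) \<or>
          (\<exists>U. cocircuit E indep U \<and> directed g U \<and> e \<in> U)) \<and>
         \<not> ((\<exists>C. circuit E indep C \<and> directed f C \<and> e \<in> C) \<and>
            (\<exists>U. cocircuit E indep U \<and> directed g U \<and> e \<in> U))"
proof -
  interpret signed_tame_matroid E indep f g
    using assms by (simp add: signed_tame_matroid_def signed_tame_matroid_axioms_def
        regular_matroid_def)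
  show ?thesis
    using directed_circuit_or_cocircuit[OF assms(2,5)] not_directed_circuit_and_cocircuit by blast
qed

end
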